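(* Let $0<r_0<r_1<r_2$, $p(r)=\frac1r$, $\rho(r)=\frac1r\left(\frac{r^2}{r_0^2}-1\right)$ on $[r_1,r_2]$, and $$\xi(r)=\int_{r_1}^r\sqrt{\frac{\rho(s)}{p(s)}}\,ds=\int_{r_1}^r\sqrt{\frac{s^2}{r_0^2}-1}\,ds,\qquad L=\xi(r_2).$$ For $m\in\mathbb N$, $m\ge1$, define the Liouville–Green quasimodes $$R_m^{(LG)}(r)=\frac{1}{(p(r)\rho(r))^{1/4}}\sin\left(\frac{\pi m}{L}\xi(r)\right).$$ Then $$\int_{r_1}^{r_2}\rho(r)R_m^{(LG)}(r)R_k^{(LG)}(r)\,dr=0\quad\text{for } m\ne k,$$ and $\|R_m^{(LG)}\|_\rho=\sqrt{L/2}$ for all $m\ge1$. Hence the functions $\hat R_m^{(LG)}=\sqrt{2/L}\,R_m^{(LG)}$, $m\ge1$, form an orthonormal system in $\mathcal H=L^2_\rho(r_1,r_2)$.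
   Context: $L^2_\rho(r_1,r_2)$ is the weighted Hilbert space with scalar product $\langle f,g\rangle_\rho=\int_{r_1}^{r_2}f(r)\overline{g(r)}\rho(r)\,dr$ and norm $\|f\|_\rho=\langle f,f\rangle_\rho^{1/2}$. *)

theory Defs
  imports "HOL-Analysis.Analysis"
begin

text \<open>
  Elements of the weighted space L^2 on (a, b) with weight w are represented by Lebesgue measurable
  functions rather than by their classes modulo a.e. equality; membership, scalar product and norm
  depend only on the class.  The end points a and b form a null set.
\<close>

definition weighted_L2 :: "(real \<Rightarrow> real) \<Rightarrow> real \<Rightarrow> real \<Rightarrow> (real \<Rightarrow> complex) set" where
  "weighted_L2 w a b =
     {f. set_borel_measurable lebesgue {a..b} f \<and>
         set_integrable lebesgue {a..b} (\<lambda>r. (cmod (f r))\<^sup>2 * w r)}"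

definition weighted_inner ::
    "(real \<Rightarrow> real) \<Rightarrow> real \<Rightarrow> real \<Rightarrow> (real \<Rightarrow> complex) \<Rightarrow> (real \<Rightarrow> complex) \<Rightarrow> complex" where
  "weighted_inner w a b f g =
     (LINT r:{a..b}|lebesgue. f r * cnj (g r) * complex_of_real (w r))"

text \<open>For a nonnegative weight the scalar product of f with itself is a nonnegative real, whence
  the real part below.\<close>

definition weighted_norm :: "(real \<Rightarrow> real) \<Rightarrow> real \<Rightarrow> real \<Rightarrow> (real \<Rightarrow> complex) \<Rightarrow> real" where
  "weighted_norm w a b f = sqrt (Re (weighted_inner w a b f f))"

definition orthonormal_system ::
    "(real \<Rightarrow> real) \<Rightarrow> real \<Rightarrow> real \<Rightarrow> 'i set \<Rightarrow> ('i \<Rightarrow> real \<Rightarrow> complex) \<Rightarrow> bool" where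
  "orthonormal_system w a b I \<phi> \<longleftrightarrow>
     (\<forall>i\<in>I. \<phi> i \<in> weighted_L2 w a b) \<and>
     (\<forall>i\<in>I. \<forall>j\<in>I. weighted_inner w a b (\<phi> i) (\<phi> j) = (if i = j then 1 else 0))"

definition p_coeff :: "real \<Rightarrow> real" where
  "p_coeff r = 1 / r"

definition rho_coeff :: "real \<Rightarrow> real \<Rightarrow> real" where
  "rho_coeff r0 r = 1 / r * (r\<^sup>2 / r0\<^sup>2 - 1)"

definition xi_LG :: "real \<Rightarrow> real \<Rightarrow> real \<Rightarrow> real" where
  "xi_LG r0 r1 r = (LINT s:{r1..r}|lebesgue. sqrt (rho_coeff r0 s / p_coeff s))"

definition L_LG :: "real \<Rightarrow> real \<Rightarrow> real \<Rightarrow> real" where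
  "L_LG r0 r1 r2 = xi_LG r0 r1 r2"

definition R_LG :: "real \<Rightarrow> real \<Rightarrow> real \<Rightarrow> nat \<Rightarrow> real \<Rightarrow> real" where
  "R_LG r0 r1 r2 m r =
     1 / (p_coeff r * rho_coeff r0 r) powr (1 / 4)
       * sin (pi * real m / L_LG r0 r1 r2 * xi_LG r0 r1 r)"

definition R_LG_hat :: "real \<Rightarrow> real \<Rightarrow> real \<Rightarrow> nat \<Rightarrow> real \<Rightarrow> real" where
  "R_LG_hat r0 r1 r2 m r = sqrt (2 / L_LG r0 r1 r2) * R_LG r0 r1 r2 m r"

end

theory Submission
  imports Defs
begin

text \<open>The weight satisfies \<open>\<rho> / (p \<rho>) powr (1/2) = sqrt (\<rho> / p) = \<xi>'\<close>.  Hence the substitution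
  \<open>t = \<xi> r\<close> turns the weighted scalar product of two quasimodes into the scalar product of
  \<open>sin (\<pi> m t / L)\<close> and \<open>sin (\<pi> k t / L)\<close> in the unweighted space over \<open>(0, L)\<close>.\<close>

lemma has_integral_deriv_times_cos:
  fixes \<xi> q :: "real \<Rightarrow> real" and j :: int
  assumes "a \<le> b" "\<xi> a = 0" "\<xi> b = L" "L \<noteq> 0"
    and \<xi>: "\<And>r. r \<in> {a..b} \<Longrightarrow> (\<xi> has_real_derivative q r) (at r within {a..b})"
  shows "((\<lambda>r. q r * cos (pi * of_int j / L * \<xi> r)) has_integral (if j = 0 then L else 0)) {a..b}"
proof (cases "j = 0")
  case True
  have "(q has_integral \<xi> b - \<xi> a) {a..b}"
    using assms by (intro fundamental_theorem_of_calculus)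
      (auto simp: has_real_derivative_iff_has_vector_derivative[symmetric])
  then show ?thesis using True assms by simp
next
  case False
  define c where "c = pi * of_int j / L"
  have c: "c \<noteq> 0" using False \<open>L \<noteq> 0\<close> by (simp add: c_def)
  \<comment> \<open>\<open>F\<close> is an antiderivative of the integrand. At both end points the
    argument \<open>c * \<xi> r\<close> is an integer multiple of \<open>pi\<close>, so its boundary
    values vanish.\<close>
  define F where "F r = sin (c * \<xi> r) / c" for r
  have "((\<lambda>r. q r * cos (c * \<xi> r)) has_integral F b - F a) {a..b}"
  proof (rule fundamental_theorem_of_calculus[OF \<open>a \<le> b\<close>])
    fix r assume "r \<in> {a..b}"
    from \<xi>[OF this] show "(F has_vector_derivative q r * cos (c * \<xi> r)) (at r within {a..b})"
      unfolding F_def has_real_derivative_iff_has_vector_derivative[symmetric]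
      using c by (auto intro!: derivative_eq_intros)
  qed
  moreover have "c * L = of_int j * pi" using \<open>L \<noteq> 0\<close> by (simp add: c_def)
  then have "F b = 0" "F a = 0"
    using assms by (simp_all add: F_def mult.commute[of _ pi])
  ultimately show ?thesis using False by (simp add: c_def)
qed

text \<open>The product-to-sum formula turns the two sines into cosines of frequencies
  \<open>m - k\<close> and \<open>m + k\<close>, of which only frequency 0 contributes. The
  difference is taken in \<open>int\<close> so that \<open>m < k\<close> causes no
  truncation.\<close>

lemma has_integral_deriv_times_sin_sin:
  fixes \<xi> q :: "real \<Rightarrow> real" and m k :: nat
  assumes "a \<le> b" "\<xi> a = 0" "\<xi> b = L" "L \<noteq> 0" "m \<ge> 1"
    and \<xi>: "\<And>r. r \<in> {a..b} \<Longrightarrow> (\<xi> has_real_derivative q r) (at r within {a..b})"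
  shows "((\<lambda>r. q r * (sin (pi * m / L * \<xi> r) * sin (pi * k / L * \<xi> r)))
            has_integral (if m = k then L / 2 else 0)) {a..b}"
proof -
  define C where "C j r = q r * cos (pi * of_int j / L * \<xi> r)" for j r
  have C: "(C j has_integral (if j = 0 then L else 0)) {a..b}" for j
    unfolding C_def using assms by (intro has_integral_deriv_times_cos) auto
  have "((\<lambda>r. (C (int m - int k) r - C (int m + int k) r) / 2)
          has_integral ((if int m - int k = 0 then L else 0) - (if int m + int k = 0 then L else 0)) / 2)
          {a..b}"
    by (intro has_integral_divide has_integral_diff C)
  also have "((if int m - int k = 0 then L else 0) - (if int m + int k = 0 then L else 0)) / 2
      = (if m = k then L / 2 else 0)"
    \<comment> \<open>Since \<open>m \<ge> 1\<close>, the frequency \<open>m + k\<close> is never 0,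
      so the cosine of the sum always drops out.\<close>
    using \<open>m \<ge> 1\<close> by auto
  also have "(\<lambda>r. (C (int m - int k) r - C (int m + int k) r) / 2)
      = (\<lambda>r. q r * (sin (pi * m / L * \<xi> r) * sin (pi * k / L * \<xi> r)))"
  proof
    fix r
    let ?u = "pi * m / L * \<xi> r" and ?v = "pi * k / L * \<xi> r"
    have "pi * of_int (int m - int k) / L * \<xi> r = ?u - ?v"
      "pi * of_int (int m + int k) / L * \<xi> r = ?u + ?v"
      by (simp_all add: algebra_simps diff_divide_distrib add_divide_distrib)
    then show "(C (int m - int k) r - C (int m + int k) r) / 2 = q r * (sin ?u * sin ?v)"
      unfolding C_def sin_times_sin by (simp only:) (simp add: right_diff_distrib)
  qed
  finally show ?thesis .
qed

lemma set_integrable_lebesgue_continuous: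
  fixes f :: "real \<Rightarrow> 'a::euclidean_space"
  assumes "continuous_on {a..b} f"
  shows "set_integrable lebesgue {a..b} f"
  using absolutely_integrable_continuous[of a b f] assms by simp

text \<open>The definitions use Lebesgue integrals, while the fundamental theorem of calculus yields
  gauge integrals; for continuous integrands this passes from one to the other.\<close>

lemma set_lebesgue_integral_continuous_eq:
  fixes f :: "real \<Rightarrow> 'a::euclidean_space"
  assumes "continuous_on {a..b} f"
  shows "(LINT r:{a..b}|lebesgue. f r) = integral {a..b} f"
  by (rule set_lebesgue_integral_eq_integral(2)[OF set_integrable_lebesgue_continuous[OF assms]])

text \<open>Continuity on a compact interval gives integrability of the weighted square, and also of
  \<open>f\<close> itself, from which the measurability of \<open>f\<close> is read off.\<close>

lemma continuous_on_imp_weighted_L2: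
  assumes "continuous_on {a..b} f" "continuous_on {a..b} w"
  shows "f \<in> weighted_L2 w a b"
  using set_integrable_lebesgue_continuous[OF assms(1)] assms
  by (auto simp: weighted_L2_def set_borel_measurable_def set_integrable_def[of _ _ f]
      dest: borel_measurable_integrable
      intro!: set_integrable_lebesgue_continuous continuous_intros)

lemma weighted_inner_of_real:
  "weighted_inner w a b (\<lambda>r. complex_of_real (f r)) (\<lambda>r. complex_of_real (g r))
     = complex_of_real (LINT r:{a..b}|lebesgue. w r * f r * g r)"
  unfolding weighted_inner_def set_integral_complex_of_real[symmetric]
  by (simp add: mult_ac)

lemma sqrt_rho_over_p:
  assumes "s \<noteq> 0"
  shows "sqrt (rho_coeff r0 s / p_coeff s) = sqrt (s\<^sup>2 / r0\<^sup>2 - 1)"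
  using assms by (simp add: rho_coeff_def p_coeff_def)

lemma rho_coeff_pos:
  assumes "0 < r0" "r0 < s"
  shows "0 < rho_coeff r0 s"
  using assms power_strict_mono[of r0 s 2] by (simp add: rho_coeff_def)

text \<open>This cancellation is what the exponent 1/4 in the amplitude is made for. The two
  amplitudes stay separate factors, as they occur in a product of two quasimodes.\<close>

lemma rho_over_amplitude_square:
  assumes "0 < p" "0 < \<rho>"
  shows "\<rho> * (1 / (p * \<rho>) powr (1 / 4)) * (1 / (p * \<rho>) powr (1 / 4)) = sqrt (\<rho> / p)"
proof -
  have "(p * \<rho>) powr (1 / 4) * (p * \<rho>) powr (1 / 4) = sqrt (p * \<rho>)"
    using assms by (simp add: powr_add[symmetric] powr_half_sqrt)
  then have "\<rho> * (1 / (p * \<rho>) powr (1 / 4)) * (1 / (p * \<rho>) powr (1 / 4)) = \<rho> / sqrt (p * \<rho>)"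
    by (simp add: divide_simps)
  also have "\<dots> = sqrt (\<rho> / p)"
    \<comment> \<open>Writing \<open>\<rho>\<close> as the square of its root lets one root cancel
      against the denominator.\<close>
    using assms real_sqrt_mult_self[of \<rho>]
    by (simp add: real_sqrt_mult real_sqrt_divide field_simps)
  finally show ?thesis .
qed

context
  fixes r0 r1 r2 :: real
  assumes r: "0 < r0" "r0 < r1" "r1 < r2"
begin

lemma continuous_on_coeffs:
  "continuous_on {r1..r2} p_coeff" "continuous_on {r1..r2} (rho_coeff r0)"
  using r by (auto simp: p_coeff_def[abs_def] rho_coeff_def[abs_def] intro!: continuous_intros)

lemma coeffs_pos:
  assumes "s \<in> {r1..r2}"
  shows "0 < p_coeff s" "0 < rho_coeff r0 s"
  using assms r rho_coeff_pos[of r0 s] by (auto simp: p_coeff_def)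

lemma continuous_on_xi_integrand:
  "continuous_on {r1..r2} (\<lambda>s. sqrt (rho_coeff r0 s / p_coeff s))"
  using coeffs_pos by (intro continuous_intros continuous_on_coeffs) force

lemma xi_LG_eq_integral:
  assumes "s \<in> {r1..r2}"
  shows "xi_LG r0 r1 s = integral {r1..s} (\<lambda>s. sqrt (rho_coeff r0 s / p_coeff s))"
  unfolding xi_LG_def using assms
  by (intro set_lebesgue_integral_continuous_eq continuous_on_subset[OF continuous_on_xi_integrand]) auto

lemma xi_LG_has_derivative:
  assumes "s \<in> {r1..r2}"
  shows "(xi_LG r0 r1 has_real_derivative sqrt (rho_coeff r0 s / p_coeff s)) (at s within {r1..r2})"
\<comment> \<open>The radius 1 is arbitrary: \<open>xi_LG\<close> agrees with the gauge primitive on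
  the whole interval.\<close>
proof (rule has_field_derivative_transform_within[OF _ zero_less_one assms])
  show "((\<lambda>u. integral {r1..u} (\<lambda>s. sqrt (rho_coeff r0 s / p_coeff s)))
      has_real_derivative sqrt (rho_coeff r0 s / p_coeff s)) (at s within {r1..r2})"
    by (rule integral_has_real_derivative[OF continuous_on_xi_integrand assms])
qed (rule xi_LG_eq_integral[symmetric])

text \<open>By the mean value theorem the total increase of \<open>xi_LG\<close> is
  \<open>r2 - r1\<close> times a value of its derivative, which is positive.\<close>

lemma L_LG_pos: "0 < L_LG r0 r1 r2"
proof -
  let ?q = "\<lambda>s. sqrt (rho_coeff r0 s / p_coeff s)"
  have "\<exists>s\<in>{r1<..<r2}. xi_LG r0 r1 r2 - xi_LG r0 r1 r1 = (\<lambda>h. ?q s * h) (r2 - r1)"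
    using r xi_LG_has_derivative by (intro mvt_simple) (auto simp: has_field_derivative_def)
  then obtain s where s: "s \<in> {r1..r2}"
    and eq: "xi_LG r0 r1 r2 - xi_LG r0 r1 r1 = ?q s * (r2 - r1)"
    by (meson greaterThanLessThan_iff atLeastAtMost_iff less_imp_le)
  have "0 < ?q s * (r2 - r1)" using r coeffs_pos[OF s] by simp
  with eq show ?thesis using r by (simp add: L_LG_def xi_LG_eq_integral)
qed

text \<open>Because \<open>r0 < r1\<close>, the product of the coefficients stays positive up to
  both end points, so the amplitude has no singularity.\<close>

lemma continuous_on_R_LG: "continuous_on {r1..r2} (R_LG r0 r1 r2 m)"
proof -
  have "continuous_on {r1..r2} (xi_LG r0 r1)"
    by (rule DERIV_continuous_on[OF xi_LG_has_derivative])
  then show ?thesis unfolding R_LG_def[abs_def] using coeffs_pos L_LG_pos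
    by (intro continuous_intros continuous_on_coeffs) (force simp: less_imp_neq[symmetric])+
qed

text \<open>Orthogonality, the norm and the normalisation are all read off from this one Gram
  matrix.\<close>

lemma integral_rho_R_LG:
  assumes "m \<ge> 1"
  shows "(LINT r:{r1..r2}|lebesgue. rho_coeff r0 r * R_LG r0 r1 r2 m r * R_LG r0 r1 r2 k r)
           = (if m = k then L_LG r0 r1 r2 / 2 else 0)"
proof -
  let ?L = "L_LG r0 r1 r2" and ?\<xi> = "xi_LG r0 r1"
  have *: "rho_coeff r0 r * R_LG r0 r1 r2 m r * R_LG r0 r1 r2 k r =
      sqrt (rho_coeff r0 r / p_coeff r) * (sin (pi * m / ?L * ?\<xi> r) * sin (pi * k / ?L * ?\<xi> r))"
    if "r \<in> {r1..r2}" for r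
    unfolding R_LG_def rho_over_amplitude_square[OF coeffs_pos[OF that], symmetric]
    by (simp only: mult_ac)
  have "((\<lambda>r. sqrt (rho_coeff r0 r / p_coeff r) *
            (sin (pi * m / ?L * ?\<xi> r) * sin (pi * k / ?L * ?\<xi> r)))
          has_integral (if m = k then ?L / 2 else 0)) {r1..r2}"
    using assms r L_LG_pos
    by (intro has_integral_deriv_times_sin_sin xi_LG_has_derivative)
       (auto simp: L_LG_def xi_LG_eq_integral)
  then have "((\<lambda>r. rho_coeff r0 r * R_LG r0 r1 r2 m r * R_LG r0 r1 r2 k r)
          has_integral (if m = k then ?L / 2 else 0)) {r1..r2}"
    using * by (subst has_integral_cong) auto
  note integral_unique[OF this]
  then show ?thesis
    by (subst set_lebesgue_integral_continuous_eq)
      (intro continuous_intros continuous_on_coeffs continuous_on_R_LG)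
qed

lemma weighted_norm_R_LG:
  assumes "m \<ge> 1"
  shows "weighted_norm (rho_coeff r0) r1 r2 (\<lambda>r. complex_of_real (R_LG r0 r1 r2 m r))
           = sqrt (L_LG r0 r1 r2 / 2)"
  unfolding weighted_norm_def weighted_inner_of_real integral_rho_R_LG[OF assms] by simp

lemma orthonormal_system_R_LG_hat:
  "orthonormal_system (rho_coeff r0) r1 r2 {1..}
     (\<lambda>m r. complex_of_real (R_LG_hat r0 r1 r2 m r))"
  unfolding orthonormal_system_def
proof (intro conjI ballI)
  fix m :: nat
  show "(\<lambda>r. complex_of_real (R_LG_hat r0 r1 r2 m r)) \<in> weighted_L2 (rho_coeff r0) r1 r2"
    unfolding R_LG_hat_def
    by (intro continuous_on_imp_weighted_L2 continuous_intros continuous_on_coeffs continuous_on_R_LG)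
next
  fix m k :: nat
  assume "m \<in> {1..}"
  let ?L = "L_LG r0 r1 r2"
  have "rho_coeff r0 r * R_LG_hat r0 r1 r2 m r * R_LG_hat r0 r1 r2 k r
      = (sqrt (2 / ?L) * sqrt (2 / ?L)) * (rho_coeff r0 r * R_LG r0 r1 r2 m r * R_LG r0 r1 r2 k r)"
    for r
    unfolding R_LG_hat_def by (simp only: mult_ac)
  \<comment> \<open>Positivity of \<open>?L\<close> makes the square of the root equal to
    \<open>2 / ?L\<close>, which scales the diagonal value \<open>?L / 2\<close> to 1.\<close>
  moreover have "sqrt (2 / ?L) * sqrt (2 / ?L) = 2 / ?L" using L_LG_pos by simp
  ultimately have "rho_coeff r0 r * R_LG_hat r0 r1 r2 m r * R_LG_hat r0 r1 r2 k r
      = 2 / ?L * (rho_coeff r0 r * R_LG r0 r1 r2 m r * R_LG r0 r1 r2 k r)" for r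
    by simp
  then show "weighted_inner (rho_coeff r0) r1 r2 (\<lambda>r. complex_of_real (R_LG_hat r0 r1 r2 m r))
      (\<lambda>r. complex_of_real (R_LG_hat r0 r1 r2 k r)) = (if m = k then 1 else 0)"
    using integral_rho_R_LG[of m k] \<open>m \<in> {1..}\<close> L_LG_pos
    by (simp only: weighted_inner_of_real set_integral_mult_right) auto
qed

end

theorem proposition5p1:
  fixes r0 r1 r2 :: real
  assumes "0 < r0" and "r0 < r1" and "r1 < r2"
  shows "(\<forall>r\<in>{r1..r2}. xi_LG r0 r1 r = (LINT s:{r1..r}|lebesgue. sqrt (s\<^sup>2 / r0\<^sup>2 - 1))) \<and>
    (\<forall>m\<ge>1. \<forall>k\<ge>1. m \<noteq> k \<longrightarrow>
       (LINT r:{r1..r2}|lebesgue. rho_coeff r0 r * R_LG r0 r1 r2 m r * R_LG r0 r1 r2 k r) = 0) \<and>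
    (\<forall>m\<ge>1. weighted_norm (rho_coeff r0) r1 r2 (\<lambda>r. complex_of_real (R_LG r0 r1 r2 m r))
              = sqrt (L_LG r0 r1 r2 / 2)) \<and>
    orthonormal_system (rho_coeff r0) r1 r2 {1..}
      (\<lambda>m r. complex_of_real (R_LG_hat r0 r1 r2 m r))"
proof (intro conjI ballI allI impI)
  fix r assume "r \<in> {r1..r2}"
  show "xi_LG r0 r1 r = (LINT s:{r1..r}|lebesgue. sqrt (s\<^sup>2 / r0\<^sup>2 - 1))"
    unfolding xi_LG_def using assms
    \<comment> \<open>The factors \<open>1 / s\<close> cancel because \<open>s\<close> is at least
      \<open>r1\<close>, hence nonzero. Stripping the roots from both sides would leave nothing for
      \<open>sqrt_rho_over_p\<close> to match.\<close>
    by (intro set_lebesgue_integral_cong) (auto simp: sqrt_rho_over_p simp del: real_sqrt_eq_iff)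
qed (use integral_rho_R_LG[OF assms] weighted_norm_R_LG[OF assms]
    orthonormal_system_R_LG_hat[OF assms] in auto)

end
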